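(* Let $f:\mathbb{D}\to\widehat{\mathbb{C}}$ be a spherically convex function. Then $$L_s f(r\mathbb{T})\ge L_s(r\mathbb{T})\,f^{\sharp}(0)\quad\text{for every } 0<r<1.$$ Moreover, equality holds for some $0<r<1$ if and only if $f$ is a spherical isometry.
   Context: $\mathbb{D}=\{z\in\mathbb{C}:|z|<1\}$, $\mathbb{T}=\partial\mathbb{D}$, $r\mathbb{T}=\{|z|=r\}$; $\widehat{\mathbb{C}}=\mathbb{C}\cup\{\infty\}$ is the Riemann sphere with the spherical metric $\frac{|dz|}{1+|z|^2}$ (Gaussian curvature $+4$). For two non-antipodal points $a,b\in\widehat{\mathbb{C}}$, the spherical geodesic joining them is the smaller arc of the great circle through $a$ and $b$. A domain $\Omega\subset\widehat{\mathbb{C}}$ is spherically convex if for any two points $a,b\in\Omega$ that are not antipodal the spherical geodesic joining $a$ and $b$ lies in $\Omega$. A meromorphic univalent (injective) map $f:\mathbb{D}\to\widehat{\mathbb{C}}$ is called spherically convex if $f(\mathbb{D})$ is a spherically convex domain. The group of (meromorphic) spherical isometries is $$\mathrm{Rot}(\widehat{\mathbb{C}})=\left\{e^{i\theta}\frac{z-a}{1+z\overline{a}}: a\in\mathbb{C},\theta\in\mathbb{R}\right\}\cup\left\{\frac{e^{i\theta}}{z}:\theta\in\mathbb{R}\right\};$$ "$f$ is a spherical isometry" means that $f$ is the restriction to $\mathbb{D}$ of an element of $\mathrm{Rot}(\widehat{\mathbb{C}})$. The spherical derivative is $f^{\sharp}(z)=\frac{|f'(z)|}{1+|f(z)|^2}$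 (at a pole of $f$ defined by continuous extension), and $$L_s f(r\mathbb{T})=\int_{r\mathbb{T}}f^{\sharp}(z)\,|dz|,\qquad L_s(r\mathbb{T})=\int_{r\mathbb{T}}\frac{|dz|}{1+|z|^2}=\frac{2\pi r}{1+r^2}.$$ *)

theory Defs
  imports "HOL-Complex_Analysis.Complex_Analysis"
begin

text \<open>The Riemann sphere is the one-point compactification of the plane, with None as the
  point at infinity.\<close>

type_synonym riemann_sphere = "complex option"

definition sphere_topology :: "riemann_sphere topology" where
  "sphere_topology = Alexandroff_compactification euclidean"

text \<open>Inverse stereographic projection onto the unit sphere of the Euclidean 3-space
  complex \<open>\<times>\<close> real, with infinity at the north pole. The metric \<open>|dz| / (1 + |z|\<^sup>2)\<close> is half
  the pullback of the round metric, so great circles and antipodal points are those of the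
  unit sphere.\<close>

fun stereo :: "riemann_sphere \<Rightarrow> complex \<times> real" where
  "stereo (Some z) = ((2 / (1 + (norm z)\<^sup>2)) *\<^sub>R z, ((norm z)\<^sup>2 - 1) / ((norm z)\<^sup>2 + 1))"
| "stereo None = (0, 1)"

definition antipodal :: "riemann_sphere \<Rightarrow> riemann_sphere \<Rightarrow> bool" where
  "antipodal a b \<longleftrightarrow> stereo b = - stereo a"

text \<open>For unit vectors p and q with \<open>q \<noteq> - p\<close>: the arc of length \<open>\<theta> < \<pi>\<close> from p to q on a great
  circle through both, traversed at unit speed with initial direction u. If \<open>p = q\<close>, then
  \<open>\<theta> = 0\<close> and the arc is \<open>{p}\<close>.\<close>

definition minor_arc :: "'a::real_inner \<Rightarrow> 'a \<Rightarrow> 'a set" where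
  "minor_arc p q = {x. \<exists>u \<theta> t. norm u = 1 \<and> p \<bullet> u = 0 \<and> 0 \<le> t \<and> t \<le> \<theta> \<and> \<theta> < pi \<and>
     q = cos \<theta> *\<^sub>R p + sin \<theta> *\<^sub>R u \<and> x = cos t *\<^sub>R p + sin t *\<^sub>R u}"

definition spherical_geodesic :: "riemann_sphere \<Rightarrow> riemann_sphere \<Rightarrow> riemann_sphere set" where
  "spherical_geodesic a b = {c. stereo c \<in> minor_arc (stereo a) (stereo b)}"

definition sphere_domain :: "riemann_sphere set \<Rightarrow> bool" where
  "sphere_domain \<Omega> \<longleftrightarrow>
     \<Omega> \<noteq> {} \<and> openin sphere_topology \<Omega> \<and> connectedin sphere_topology \<Omega>"

definition spherically_convex :: "riemann_sphere set \<Rightarrow> bool" where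
  "spherically_convex \<Omega> \<longleftrightarrow> sphere_domain \<Omega> \<and>
     (\<forall>a\<in>\<Omega>. \<forall>b\<in>\<Omega>. \<not> antipodal a b \<longrightarrow> spherical_geodesic a b \<subseteq> \<Omega>)"

text \<open>A function that is nicely meromorphic on S has removable singularities removed and takes
  the dummy value 0 at its poles. It represents the map from S into the Riemann sphere that
  sends the poles to infinity; every meromorphic map from the disc into the sphere, other than
  the constant infinity, has exactly one such representative on the disc.\<close>

definition sphere_map :: "(complex \<Rightarrow> complex) \<Rightarrow> complex \<Rightarrow> riemann_sphere" where
  "sphere_map f z = (if is_pole f z then None else Some (f z))"

definition spherically_convex_function :: "(complex \<Rightarrow> complex) \<Rightarrow> bool" where
  "spherically_convex_function f \<longleftrightarrow>
     f nicely_meromorphic_on ball 0 1 \<and>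
     inj_on (sphere_map f) (ball 0 1) \<and>
     spherically_convex (sphere_map f ` ball 0 1)"

text \<open>The Moebius transformation \<open>e\<^sup>i\<^sup>\<theta> (z - a) / (1 + z a')\<close>, \<open>a'\<close> the conjugate of \<open>a\<close>,
  extended to the whole sphere.\<close>

fun rotation :: "real \<Rightarrow> complex \<Rightarrow> riemann_sphere \<Rightarrow> riemann_sphere" where
  "rotation \<theta> a (Some z) =
     (if 1 + z * cnj a = 0 then None else Some (cis \<theta> * ((z - a) / (1 + z * cnj a))))"
| "rotation \<theta> a None = (if a = 0 then None else Some (cis \<theta> / cnj a))"

fun inversion_rotation :: "real \<Rightarrow> riemann_sphere \<Rightarrow> riemann_sphere" where
  "inversion_rotation \<theta> (Some z) = (if z = 0 then None else Some (cis \<theta> / z))"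
| "inversion_rotation \<theta> None = Some 0"

definition Rot :: "(riemann_sphere \<Rightarrow> riemann_sphere) set" where
  "Rot = {rotation \<theta> a | \<theta> a. True} \<union> range inversion_rotation"

definition is_spherical_isometry :: "(complex \<Rightarrow> complex) \<Rightarrow> bool" where
  "is_spherical_isometry f \<longleftrightarrow> (\<exists>\<rho>\<in>Rot. \<forall>z\<in>ball 0 1. sphere_map f z = \<rho> (Some z))"

definition spherical_deriv :: "(complex \<Rightarrow> complex) \<Rightarrow> complex \<Rightarrow> real" where
  "spherical_deriv f z =
     (if is_pole f z then Lim (at z) (\<lambda>w. norm (deriv f w) / (1 + (norm (f w))\<^sup>2))
      else norm (deriv f z) / (1 + (norm (f z))\<^sup>2))"

text \<open>The integral of h with respect to arc length \<open>|dz|\<close>.\<close>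

definition arclength_integral :: "(real \<Rightarrow> complex) \<Rightarrow> (complex \<Rightarrow> real) \<Rightarrow> real" where
  "arclength_integral \<gamma> h =
     integral {0..1} (\<lambda>t. h (\<gamma> t) * norm (vector_derivative \<gamma> (at t within {0..1})))"

definition spherical_length_image :: "(complex \<Rightarrow> complex) \<Rightarrow> real \<Rightarrow> real" where
  "spherical_length_image f r = arclength_integral (circlepath 0 r) (spherical_deriv f)"

definition spherical_length_circle :: "real \<Rightarrow> real" where
  "spherical_length_circle r = arclength_integral (circlepath 0 r) (\<lambda>z. 1 / (1 + (norm z)\<^sup>2))"

end

theory Submission
  imports Defs
begin

text \<open>A spherically convex set that is not the whole sphere lies in a
  hemisphere: the cone over it in 3-space is convex and misses the origin, so it lies in a
  half-space with the origin on its boundary (\<open>spherically_convex_hemisphere\<close>). The image of \<open>f\<close> cannot be the whole sphere by Liouville's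
  theorem (\<open>sphere_map_image_neq_UNIV\<close>). Rotating the hemisphere to the unit disc turns \<open>f\<close> into an
  injective holomorphic map \<open>g\<close> from the disc into itself with the same spherical derivative, so it
  has to be shown that the mean of \<open>g\<^sup>\<sharp> = |g'| / (1 + |g|\<^sup>2)\<close> over \<open>|z| = r\<close> is at least
  \<open>g\<^sup>\<sharp>(0) / (1 + r\<^sup>2)\<close>, with equality only for \<open>g z = \<alpha> z\<close> with \<open>|\<alpha>| = 1\<close>.

  If \<open>g\<close> fixes 0, this is quick: \<open>|g| \<le> r\<close> on the circle by Schwarz's lemma, and the mean of
  \<open>|g'|\<close> is at least \<open>|g' 0|\<close>. In general \<open>g\<close> is moved by an automorphism of the disc to a map \<open>\<omega>\<close>
  that fixes 0, and \<open>g\<^sup>\<sharp>\<close> becomes a constant multiple of \<open>|\<omega>'| / (1 + |\<omega>|\<^sup>2 + Re (c \<omega>))\<close>, where the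
  constant \<open>c\<close> with \<open>|c| < 2\<close> vanishes only if \<open>g\<close> fixes 0. The linear term has mean zero, but it
  stands in the denominator; passing to the square root of \<open>\<omega>'\<close>, which exists because \<open>g\<close> is injective,
  and the inequality between arithmetic and geometric means produce a harmonic minorant in which
  that term enters linearly and does no harm (\<open>circle_mean_weighted_derivative\<close>).\<close>

section \<open>Means over circles\<close>

text \<open>The mean value property, read off from Cauchy's formula at the centre: the kernel
  \<open>1 / u\<close> cancels against the derivative of the circle, which is \<open>2\<pi>i u\<close>.\<close>

lemma has_integral_circle_mean:
  assumes holF: "F holomorphic_on ball 0 1" and r: "0 < r" "r < 1"
  shows "((\<lambda>t. F (circlepath 0 r t)) has_integral F 0) {0..1}"
proof -
  let ?k = "2 * of_real pi * \<i> :: complex"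
  have "F holomorphic_on cball 0 r"
    using holF by (rule holomorphic_on_subset) (use r in auto)
  then have "continuous_on (cball 0 r) F" "F holomorphic_on ball 0 r"
    by (auto intro: holomorphic_on_imp_continuous_on holomorphic_on_subset)
  then have "((\<lambda>u. F u / (u - 0)) has_contour_integral (?k * F 0)) (circlepath 0 r)"
    by (rule Cauchy_integral_circlepath) (use r in auto)
  then have "((\<lambda>t. F (circlepath 0 r t) / circlepath 0 r t *
      vector_derivative (circlepath 0 r) (at t within {0..1})) has_integral (?k * F 0)) {0..1}"
    by (simp add: has_contour_integral_def)
  then have "((\<lambda>t. ?k * F (circlepath 0 r t)) has_integral (?k * F 0)) {0..1}"
  proof (rule has_integral_eq[rotated])
    fix t :: real assume "t \<in> {0..1}"
    then have "vector_derivative (circlepath 0 r) (at t within {0..1}) = ?k * circlepath 0 r t"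
      by (simp add: vector_derivative_circlepath01) (simp add: circlepath)
    moreover have "circlepath 0 r t \<noteq> 0" using r by (simp add: circlepath)
    ultimately show "F (circlepath 0 r t) / circlepath 0 r t *
        vector_derivative (circlepath 0 r) (at t within {0..1}) = ?k * F (circlepath 0 r t)"
      by simp
  qed
  from has_integral_mult_right[OF this, of "inverse ?k"] show ?thesis
    by (simp add: field_simps)
qed

lemma norm_circlepath_0: "0 < r \<Longrightarrow> norm (circlepath 0 r t) = r"
  by (simp add: circlepath norm_mult)

lemma continuous_on_circle_values:
  assumes "continuous_on (ball 0 1) h" "0 < r" "r < 1"
  shows "continuous_on {0..1} (\<lambda>t. h (circlepath 0 r t))"
  using assms
  by (intro continuous_on_compose2[OF assms(1)])
     (auto simp: circlepath norm_mult intro!: continuous_intros)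

text \<open>A real function that dominates a harmonic function on a circle has a mean at least the
  harmonic value at the centre. If the two agree, the nonnegative continuous difference has
  integral zero, so the function coincides with its harmonic minorant on the whole circle; all
  information about the case of equality is extracted from this.\<close>

lemma integral_ge_harmonic_value:
  assumes h: "continuous_on (ball 0 1) h" and F: "F holomorphic_on ball 0 1"
    and r: "0 < r" "r < 1"
    and le: "\<And>z. norm z = r \<Longrightarrow> Re (F z) \<le> h z"
  shows "Re (F 0) \<le> integral {0..1} (\<lambda>t. h (circlepath 0 r t))"
    and "integral {0..1} (\<lambda>t. h (circlepath 0 r t)) = Re (F 0) \<Longrightarrow> norm z = r \<Longrightarrow> h z = Re (F z)"
proof -
  let ?\<gamma> = "circlepath 0 r"
  have F_int: "((\<lambda>t. Re (F (?\<gamma> t))) has_integral Re (F 0)) {0..1}"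
    using has_integral_linear[OF has_integral_circle_mean[OF F r] bounded_linear_Re]
    by (simp add: o_def)
  have cont_h: "continuous_on {0..1} (\<lambda>t. h (?\<gamma> t))"
    by (rule continuous_on_circle_values[OF h r])
  have "continuous_on (ball 0 1) (\<lambda>z. Re (F z))"
    using holomorphic_on_imp_continuous_on[OF F] by (intro continuous_intros)
  from continuous_on_circle_values[OF this r]
  have cont_F: "continuous_on {0..1} (\<lambda>t. Re (F (?\<gamma> t)))" .
  have diff: "((\<lambda>t. h (?\<gamma> t) - Re (F (?\<gamma> t))) has_integral
      integral {0..1} (\<lambda>t. h (?\<gamma> t)) - Re (F 0)) {0..1}"
    by (rule has_integral_diff[OF integrable_integral[OF integrable_continuous_interval[OF cont_h]] F_int])
  have nonneg: "0 \<le> h (?\<gamma> t) - Re (F (?\<gamma> t))" for t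
    using le norm_circlepath_0[OF r(1)] by simp
  from has_integral_nonneg[OF diff nonneg]
  show "Re (F 0) \<le> integral {0..1} (\<lambda>t. h (?\<gamma> t))" by simp
  assume "integral {0..1} (\<lambda>t. h (?\<gamma> t)) = Re (F 0)" and z: "norm z = r"
  with diff have "integral {0..1} (\<lambda>t. h (?\<gamma> t) - Re (F (?\<gamma> t))) = 0"
    by (simp add: integral_unique)
  then have eq: "\<forall>t\<in>{0..1}. h (?\<gamma> t) - Re (F (?\<gamma> t)) = 0"
    using integral_eq_0_iff[OF continuous_on_diff[OF cont_h cont_F]] nonneg by simp
  have "z \<in> path_image (circlepath 0 r)"
    using z r by (simp add: path_image_circlepath_nonneg)
  with eq show "h z = Re (F z)"
    by (auto simp: path_image_def)
qed

section \<open>The sharp estimate for injective self-maps of the disc\<close>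

text \<open>Since \<open>|c| < 2\<close>, the value is strictly larger than \<open>(1 - |w|)\<^sup>2\<close> unless \<open>w = 0\<close>.\<close>

lemma weighted_derivative_denom_pos:
  fixes c w :: complex
  assumes "norm c < 2"
  shows "0 < 1 + (norm w)\<^sup>2 + Re (c * w)"
proof (cases "w = 0")
  case False
  have "- Re (c * w) \<le> norm c * norm w"
    using abs_Re_le_cmod[of "c * w"] by (simp add: norm_mult)
  also have "\<dots> < 2 * norm w" using assms False by simp
  also have "\<dots> \<le> 1 + (norm w)\<^sup>2"
    using sum_squares_bound[of 1 "norm w"] by simp
  finally show ?thesis by simp
qed simp

text \<open>The estimate rests on a harmonic minorant for \<open>|\<omega>'| / Q\<close>, where
  \<open>Q = 1 + |\<omega>|\<^sup>2 + Re (c \<omega>)\<close>. As \<open>\<omega>'\<close> has no zeros, \<open>\<omega>' = p\<^sup>2\<close> with \<open>p\<close> holomorphic, and for each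
  constant \<open>s > 0\<close> the inequality between arithmetic and geometric means gives
  \<open>|p|\<^sup>2 / Q \<ge> 2 s |p| - s\<^sup>2 Q\<close>. On \<open>|z| = r\<close> the first term is bounded below by \<open>2 s Re (u p)\<close> with a
  constant \<open>|u| = 1\<close>, and Schwarz's lemma bounds \<open>Q\<close> above by \<open>1 + r\<^sup>2 + Re (c \<omega>)\<close>. Both bounds are
  harmonic, and what they give at 0 is \<open>2 s |p 0| - s\<^sup>2 (1 + r\<^sup>2)\<close>.
  
  In the case of equality, equality in Schwarz's lemma makes \<open>\<omega>\<close> a rotation of the disc, so \<open>p\<close> has
  constant modulus, and equality between the two means then forces \<open>Q\<close> to be constant on the circle. This is
  only possible for \<open>c = 0\<close>.\<close>

theorem circle_mean_weighted_derivative: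
  fixes \<omega> :: "complex \<Rightarrow> complex" and c :: complex
  defines "h \<equiv> \<lambda>z. norm (deriv \<omega> z) / (1 + (norm (\<omega> z))\<^sup>2 + Re (c * \<omega> z))"
  assumes hol: "\<omega> holomorphic_on ball 0 1" and zero: "\<omega> 0 = 0"
    and lt1: "\<And>z. norm z < 1 \<Longrightarrow> norm (\<omega> z) < 1"
    and deriv_nz: "\<And>z. norm z < 1 \<Longrightarrow> deriv \<omega> z \<noteq> 0"
    and c: "norm c < 2" and r: "0 < r" "r < 1"
  shows "norm (deriv \<omega> 0) / (1 + r\<^sup>2) \<le> integral {0..1} (\<lambda>t. h (circlepath 0 r t))"
    and "integral {0..1} (\<lambda>t. h (circlepath 0 r t)) = norm (deriv \<omega> 0) / (1 + r\<^sup>2) \<Longrightarrow>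
           c = 0 \<and> (\<exists>\<alpha>. norm \<alpha> = 1 \<and> (\<forall>z. norm z < 1 \<longrightarrow> \<omega> z = \<alpha> * z))"
proof -
  define Q where "Q z = 1 + (norm (\<omega> z))\<^sup>2 + Re (c * \<omega> z)" for z
  have Q_pos: "Q z > 0" for z
    unfolding Q_def using c by (rule weighted_derivative_denom_pos)
  have hol': "deriv \<omega> holomorphic_on ball 0 1"
    using hol by (intro holomorphic_deriv) auto
  obtain p where p: "p holomorphic_on ball 0 1" "\<And>z. z \<in> ball 0 1 \<Longrightarrow> deriv \<omega> z = (p z)\<^sup>2"
    using contractible_imp_holomorphic_sqrt[OF hol' convex_imp_contractible[OF convex_ball]] deriv_nz
    by (metis dist_0_norm mem_ball)
  have np: "norm (deriv \<omega> z) = (norm (p z))\<^sup>2" if "norm z < 1" for z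
    using p(2)[of z] that by (simp add: norm_power)
  have p0: "p 0 \<noteq> 0" using p(2)[of 0] deriv_nz[of 0] by auto
  \<comment> \<open>This unimodular constant makes \<open>Re (u p) \<le> |p|\<close> an equality at 0.\<close>
  define u where "u = cnj (p 0) / norm (p 0)"
  have u: "norm u = 1" "u * p 0 = norm (p 0)"
    using p0 by (auto simp: u_def norm_divide complex_norm_square[symmetric] power2_eq_square
        mult.commute[of "cnj _"])
  \<comment> \<open>The maximiser of the quadratic \<open>2 s |p 0| - s\<^sup>2 (1 + r\<^sup>2)\<close>.\<close>
  define s where "s = norm (p 0) / (1 + r\<^sup>2)"
  have s: "s > 0" using p0 unfolding s_def by (intro divide_pos_pos) (auto simp: add_pos_nonneg)
  define F where "F z = of_real (2 * s) * (u * p z) - of_real (s\<^sup>2) * (of_real (1 + r\<^sup>2) + c * \<omega> z)" for z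
  have holF: "F holomorphic_on ball 0 1"
    unfolding F_def using p(1) hol by (intro holomorphic_intros)
  have F0: "Re (F 0) = norm (deriv \<omega> 0) / (1 + r\<^sup>2)"
  proof -
    have "Re (F 0) = 2 * s * norm (p 0) - s\<^sup>2 * (1 + r\<^sup>2)"
      unfolding F_def u(2) zero by (simp flip: of_real_power)
    also have "\<dots> = (norm (p 0))\<^sup>2 / (1 + r\<^sup>2)"
    proof -
      have "2 * (n / d) * n - (n / d)\<^sup>2 * d = n\<^sup>2 / d" if "d \<noteq> 0" for n d :: real
        using that by (simp add: field_simps power2_eq_square)
      moreover have "1 + r\<^sup>2 \<noteq> 0" by (smt (verit) zero_le_power2)
      ultimately show ?thesis unfolding s_def by blast
    qed
    finally show ?thesis using np[of 0] by simp
  qed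
  have ReF: "Re (F z) = 2 * s * Re (u * p z) - s\<^sup>2 * (1 + r\<^sup>2 + Re (c * \<omega> z))" for z
    unfolding F_def by (simp flip: of_real_power)
  \<comment> \<open>The three losses of the argument: the inequality of the means, the replacement of \<open>|p|\<close> by
    \<open>Re (u p)\<close>, and Schwarz's lemma. Each is nonnegative on the circle.\<close>
  have gap: "h z - Re (F z) = (norm (p z) - s * Q z)\<^sup>2 / Q z
      + 2 * s * (norm (p z) - Re (u * p z)) + s\<^sup>2 * (r\<^sup>2 - (norm (\<omega> z))\<^sup>2)" if "norm z < 1" for z
  proof -
    have "(norm (p z) - s * Q z)\<^sup>2 / Q z = (norm (p z))\<^sup>2 / Q z - 2 * s * norm (p z) + s\<^sup>2 * Q z"
      using Q_pos[of z] by (simp add: field_simps power2_eq_square)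
    then show ?thesis
      unfolding ReF h_def Q_def[symmetric] np[OF that] by (simp add: Q_def algebra_simps)
  qed
  have Re_up: "Re (u * p z) \<le> norm (p z)" for z
    using complex_Re_le_cmod[of "u * p z"] u(1) by (simp add: norm_mult)
  have schwarz: "norm (\<omega> z) \<le> norm z" if "norm z < 1" for z
    using Schwarz_Lemma(1)[OF hol zero lt1 that] .
  have terms: "0 \<le> (norm (p z) - s * Q z)\<^sup>2 / Q z" "0 \<le> 2 * s * (norm (p z) - Re (u * p z))"
      "0 \<le> s\<^sup>2 * (r\<^sup>2 - (norm (\<omega> z))\<^sup>2)" if "norm z = r" for z
    using Q_pos[of z] s Re_up[of z] schwarz[of z] that r
    by (auto intro!: mult_nonneg_nonneg power_mono)
  have le: "Re (F z) \<le> h z" if "norm z = r" for z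
    using gap[of z] terms[OF that] that r by linarith
  have cont_h: "continuous_on (ball 0 1) h"
  proof -
    note cont = holomorphic_on_imp_continuous_on[OF hol] holomorphic_on_imp_continuous_on[OF hol']
    show ?thesis unfolding h_def
      using cont Q_pos unfolding Q_def by (intro continuous_intros) (auto simp: less_imp_neq[symmetric])
  qed
  show "norm (deriv \<omega> 0) / (1 + r\<^sup>2) \<le> integral {0..1} (\<lambda>t. h (circlepath 0 r t))"
    using integral_ge_harmonic_value(1)[OF cont_h holF r le] F0 by simp
  assume "integral {0..1} (\<lambda>t. h (circlepath 0 r t)) = norm (deriv \<omega> 0) / (1 + r\<^sup>2)"
  then have hF: "h z = Re (F z)" if "norm z = r" for z
    using integral_ge_harmonic_value(2)[OF cont_h holF r le] F0 that by simp
  have sq: "(norm (p z) - s * Q z)\<^sup>2 / Q z = 0" if "norm z = r" for z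
    using hF[OF that] gap[of z] terms[OF that] that r by linarith
  have om: "s\<^sup>2 * (r\<^sup>2 - (norm (\<omega> z))\<^sup>2) = 0" if "norm z = r" for z
    using hF[OF that] gap[of z] terms[OF that] that r by linarith
  have "norm (\<omega> z) = norm z" if "norm z = r" for z
    using om[OF that] s r that by simp
  from this[of "of_real r"] have
    "\<exists>z. norm z < 1 \<and> z \<noteq> 0 \<and> norm (\<omega> z) = norm z"
    using r by (intro exI[of _ "of_real r"]) simp
  then obtain \<alpha> where \<alpha>: "\<And>z. norm z < 1 \<Longrightarrow> \<omega> z = \<alpha> * z" "norm \<alpha> = 1"
    using Schwarz_Lemma(3)[OF hol zero lt1, of 0] by auto
  have "deriv \<omega> z = \<alpha>" if "norm z < 1" for z
  proof -
    have "deriv \<omega> z = deriv (\<lambda>z. \<alpha> * z) z"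
      using \<alpha>(1) that
      by (intro deriv_cong_ev eventually_mono[OF eventually_nhds_in_open[of "ball 0 1"]]) auto
    then show ?thesis by simp
  qed
  then have p1: "norm (p z) = 1" if "norm z < 1" for z
  proof -
    have "(norm (p z))\<^sup>2 = 1"
      using np[OF that] that \<alpha>(2) \<open>\<And>z. norm z < 1 \<Longrightarrow> deriv \<omega> z = \<alpha>\<close> by simp
    then show ?thesis
      using norm_ge_zero[of "p z"] unfolding power2_eq_1_iff by linarith
  qed
  have Qr: "Q z = 1 + r\<^sup>2" if "norm z = r" for z
    using sq[OF that] Q_pos[of z] p1[of z] p1[of 0] that r unfolding s_def
    by (auto simp: field_simps)
  have "Re (c * (\<alpha> * z)) = 0" if "norm z = r" for z
    using Qr[OF that] that r \<alpha> unfolding Q_def by (simp add: norm_mult)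
  \<comment> \<open>At this point of the circle \<open>c \<alpha> z\<close> is \<open>r |c \<alpha>|\<close>, a positive real number if \<open>c \<noteq> 0\<close>.\<close>
  from this[of "of_real r * (cnj (c * \<alpha>) / norm (c * \<alpha>))"]
  have "c = 0"
  proof (rule_tac ccontr)
    assume *: "norm (of_real r * (cnj (c * \<alpha>) / norm (c * \<alpha>))) = r \<Longrightarrow>
      Re (c * (\<alpha> * (of_real r * (cnj (c * \<alpha>) / norm (c * \<alpha>))))) = 0" and "c \<noteq> 0"
    then have nz: "c * \<alpha> \<noteq> 0" using \<alpha>(2) by auto
    have "c * (\<alpha> * (of_real r * (cnj (c * \<alpha>) / norm (c * \<alpha>)))) = of_real r * ((c * \<alpha>) * cnj (c * \<alpha>)) / norm (c * \<alpha>)"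
      by (simp add: algebra_simps)
    also have "\<dots> = of_real (r * norm (c * \<alpha>))"
      using nz unfolding complex_norm_square[symmetric] by (simp add: power2_eq_square)
    finally have "Re (c * (\<alpha> * (of_real r * (cnj (c * \<alpha>) / norm (c * \<alpha>))))) = r * norm (c * \<alpha>)"
      by (metis Re_complex_of_real)
    moreover have "norm (of_real r * (cnj (c * \<alpha>) / norm (c * \<alpha>))) = r"
      using nz r by (simp add: norm_mult norm_divide)
    ultimately show False using * nz r by simp
  qed
  with \<alpha> show "c = 0 \<and> (\<exists>\<alpha>. norm \<alpha> = 1 \<and> (\<forall>z. norm z < 1 \<longrightarrow> \<omega> z = \<alpha> * z))"
    by blast
qed

text \<open>With \<open>T w = (w - a) / (1 - a' w)\<close>, where \<open>a'\<close> is the conjugate of \<open>a\<close>, this is the identity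
  \<open>1 + |T w|\<^sup>2 + Re (c T w) = (1 + |w|\<^sup>2) (1 - |a|\<^sup>2)\<^sup>2 / ((1 + |a|\<^sup>2) |1 - a' w|\<^sup>2)\<close> for
  \<open>c = 4 a' / (1 + |a|\<^sup>2)\<close>, cleared of denominators.\<close>

lemma moebius_disc_identity:
  fixes a w :: complex
  shows "(1 + (norm a)\<^sup>2) * ((norm (1 - cnj a * w))\<^sup>2 + (norm (w - a))\<^sup>2)
           + 4 * Re (cnj a * ((w - a) * cnj (1 - cnj a * w)))
         = (1 + (norm w)\<^sup>2) * (1 - (norm a)\<^sup>2)\<^sup>2"
  unfolding cmod_power2 by (simp add: algebra_simps power2_eq_square)

text \<open>The previous estimate requires a fixed point at 0, so \<open>g\<close> is followed by the automorphism of the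
  disc that sends \<open>a = g 0\<close> to 0; call the result \<open>\<omega>\<close>. This automorphism is not a spherical
  isometry, and its distortion is exactly what the term \<open>Re (c \<omega>)\<close> records: up to the constant
  \<open>k\<close>, the spherical derivative of \<open>g\<close> is \<open>|\<omega>'| / (1 + |\<omega>|\<^sup>2 + Re (c \<omega>))\<close>. Equality gives \<open>c = 0\<close>,
  that is \<open>a = 0\<close> and \<open>g = \<omega>\<close>.\<close>

theorem circle_mean_spherical_derivative_disc:
  fixes g :: "complex \<Rightarrow> complex"
  defines "G \<equiv> \<lambda>z. norm (deriv g z) / (1 + (norm (g z))\<^sup>2)"
  assumes hol: "g holomorphic_on ball 0 1" and inj: "inj_on g (ball 0 1)"
    and lt1: "\<And>z. norm z < 1 \<Longrightarrow> norm (g z) < 1"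
    and r: "0 < r" "r < 1"
  shows "G 0 / (1 + r\<^sup>2) \<le> integral {0..1} (\<lambda>t. G (circlepath 0 r t))"
    and "integral {0..1} (\<lambda>t. G (circlepath 0 r t)) = G 0 / (1 + r\<^sup>2) \<Longrightarrow>
           \<exists>\<alpha>. norm \<alpha> = 1 \<and> (\<forall>z. norm z < 1 \<longrightarrow> g z = \<alpha> * z)"
proof -
  define a where "a = g 0"
  have a: "norm a < 1" using lt1[of 0] by (simp add: a_def)
  have a2: "(norm a)\<^sup>2 < 1" using a by (simp add: power_less_one_iff abs_square_less_1)
  define \<omega> where "\<omega> z = Moebius_function 0 a (g z)" for z
  define c where "c = 4 * cnj a / of_real (1 + (norm a)\<^sup>2)"
  define k where "k = (1 - (norm a)\<^sup>2) / (1 + (norm a)\<^sup>2)"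
  define h where "h z = norm (deriv \<omega> z) / (1 + (norm (\<omega> z))\<^sup>2 + Re (c * \<omega> z))" for z
  have pa: "1 + (norm a)\<^sup>2 > 0" by (smt (verit) zero_le_power2)
  have k: "k > 0" using a2 pa by (simp add: k_def)
  have \<omega>_eq: "\<omega> z = (g z - a) / (1 - cnj a * g z)" for z
    by (simp add: \<omega>_def Moebius_function_simple)
  have den: "1 - cnj a * g z \<noteq> 0" if "norm z < 1" for z
  proof
    assume "1 - cnj a * g z = 0"
    then have "norm a * norm (g z) = 1"
      by (metis complex_mod_cnj eq_iff_diff_eq_0 norm_mult norm_one)
    moreover have "norm a * norm (g z) < 1 * 1"
      using a lt1[OF that] by (intro mult_strict_mono') auto
    ultimately show False by simp
  qed
  have hol\<omega>: "\<omega> holomorphic_on ball 0 1"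
    unfolding \<omega>_eq using den by (intro holomorphic_intros hol) auto
  have \<omega>0: "\<omega> 0 = 0" by (simp add: \<omega>_eq a_def)
  have \<omega>1: "norm (\<omega> z) < 1" if "norm z < 1" for z
    unfolding \<omega>_def using a lt1[OF that] by (rule Moebius_function_norm_lt_1)
  have c: "norm c < 2"
  proof -
    have "0 < (1 - norm a)\<^sup>2" using a by simp
    then have "4 * norm a < 2 * (1 + (norm a)\<^sup>2)" by (simp add: power2_eq_square algebra_simps)
    moreover have "norm c = 4 * norm a / (1 + (norm a)\<^sup>2)"
      using pa unfolding c_def norm_divide norm_of_real norm_mult by simp
    ultimately show ?thesis using pa by (simp add: pos_divide_less_eq)
  qed
  have deriv\<omega>: "deriv \<omega> z = deriv g z * of_real (1 - (norm a)\<^sup>2) / (1 - cnj a * g z)\<^sup>2"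
    if z: "norm z < 1" for z
  proof (rule DERIV_imp_deriv)
    have "(g has_field_derivative deriv g z) (at z)"
      using holomorphic_derivI[OF hol] z by simp
    note [derivative_intros] = this
    have "(\<omega> has_field_derivative
        ((deriv g z - 0) * (1 - cnj a * g z) - (g z - a) * (0 - cnj a * deriv g z)) /
        ((1 - cnj a * g z) * (1 - cnj a * g z))) (at z)"
      unfolding \<omega>_eq using den[OF z] by (auto intro!: derivative_eq_intros)
    moreover have "(deriv g z - 0) * (1 - cnj a * g z) - (g z - a) * (0 - cnj a * deriv g z)
        = deriv g z * of_real (1 - (norm a)\<^sup>2)"
      unfolding of_real_diff complex_norm_square by (simp add: algebra_simps)
    ultimately show "(\<omega> has_field_derivative
        deriv g z * of_real (1 - (norm a)\<^sup>2) / (1 - cnj a * g z)\<^sup>2) (at z)"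
      by (simp add: power2_eq_square)
  qed
  have nz: "deriv \<omega> z \<noteq> 0" if "norm z < 1" for z
    using holomorphic_injective_imp_regular[OF hol open_ball inj, of z] that den[OF that] a2
    unfolding deriv\<omega>[OF that] by (simp flip: of_real_power)
  have Gh: "G z = k * h z" if z: "norm z < 1" for z
  proof -
    define N where "N = (norm (1 - cnj a * g z))\<^sup>2"
    define Q where "Q = 1 + (norm (\<omega> z))\<^sup>2 + Re (c * \<omega> z)"
    have Re_of_real_mult: "Re (of_real x * y) = x * Re y" for x y by simp
    have N: "N > 0" using den[OF z] by (simp add: N_def)
    have Q: "Q > 0" unfolding Q_def using c by (rule weighted_derivative_denom_pos)
    have "\<omega> z = (g z - a) * cnj (1 - cnj a * g z) / of_real N"
      unfolding \<omega>_eq N_def by (rule complex_div_cnj)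
    then have "c * \<omega> z = of_real (4 / ((1 + (norm a)\<^sup>2) * N)) * (cnj a * ((g z - a) * cnj (1 - cnj a * g z)))"
      unfolding c_def by simp
    then have Re_eq: "Re (c * \<omega> z) = 4 / ((1 + (norm a)\<^sup>2) * N) *
        Re (cnj a * ((g z - a) * cnj (1 - cnj a * g z)))"
      by (simp only: Re_of_real_mult)
    have norm_eq: "(norm (\<omega> z))\<^sup>2 = (norm (g z - a))\<^sup>2 / N"
      unfolding \<omega>_eq N_def by (simp add: norm_divide power_divide)
    have "A * (N * (1 + y / N + 4 / (A * N) * x)) = A * (N + y) + 4 * x" if "A > 0" for A x y :: real
      using that N by (simp add: field_simps)
    from this[OF pa] have "(1 + (norm a)\<^sup>2) * (N * Q) = (1 + (norm a)\<^sup>2) * (N + (norm (g z - a))\<^sup>2)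
           + 4 * Re (cnj a * ((g z - a) * cnj (1 - cnj a * g z)))"
      unfolding Q_def Re_eq norm_eq by blast
    also have "\<dots> = (1 + (norm (g z))\<^sup>2) * (1 - (norm a)\<^sup>2)\<^sup>2"
      unfolding N_def by (rule moebius_disc_identity)
    finally have NQ: "(1 + (norm a)\<^sup>2) * (N * Q) = (1 + (norm (g z))\<^sup>2) * (1 - (norm a)\<^sup>2)\<^sup>2" .
    have "norm (deriv \<omega> z) = norm (deriv g z) * (1 - (norm a)\<^sup>2) / N"
      unfolding deriv\<omega>[OF z] norm_divide norm_mult norm_of_real norm_power N_def using a2 by simp
    then have "k * h z = norm (deriv g z) * (1 - (norm a)\<^sup>2)\<^sup>2 / ((1 + (norm a)\<^sup>2) * (N * Q))"
      unfolding h_def k_def Q_def[symmetric] by (simp add: power2_eq_square)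
    also have "\<dots> = G z"
      unfolding NQ G_def using a2 by simp
    finally show ?thesis by simp
  qed
  have G0: "G 0 = k * norm (deriv \<omega> 0)"
    using Gh[of 0] by (simp add: h_def \<omega>0)
  have int: "integral {0..1} (\<lambda>t. G (circlepath 0 r t)) = k * integral {0..1} (\<lambda>t. h (circlepath 0 r t))"
    using Gh norm_circlepath_0[OF r(1)] r by simp
  note main = circle_mean_weighted_derivative[OF hol\<omega> \<omega>0 \<omega>1 nz c r, folded h_def]
  show "G 0 / (1 + r\<^sup>2) \<le> integral {0..1} (\<lambda>t. G (circlepath 0 r t))"
    unfolding int G0 using mult_left_mono[OF main(1), of k] k by simp
  assume "integral {0..1} (\<lambda>t. G (circlepath 0 r t)) = G 0 / (1 + r\<^sup>2)"
  then have "k * integral {0..1} (\<lambda>t. h (circlepath 0 r t)) = k * (norm (deriv \<omega> 0) / (1 + r\<^sup>2))"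
    unfolding int G0 by simp
  then have "integral {0..1} (\<lambda>t. h (circlepath 0 r t)) = norm (deriv \<omega> 0) / (1 + r\<^sup>2)"
    using k unfolding mult_cancel_left by simp
  from main(2)[OF _ _ this] obtain \<alpha> where
    "c = 0" "norm \<alpha> = 1" "\<And>z. norm z < 1 \<Longrightarrow> \<omega> z = \<alpha> * z" by blast
  moreover from this have "a = 0" using pa unfolding c_def by (simp flip: of_real_power of_real_add)
  ultimately show "\<exists>\<alpha>. norm \<alpha> = 1 \<and> (\<forall>z. norm z < 1 \<longrightarrow> g z = \<alpha> * z)"
    by (auto simp: \<omega>_eq)
qed

section \<open>Rotations of the sphere and the spherical derivative\<close>

text \<open>For \<open>(A, B) \<noteq> 0\<close> this is a rotation of the sphere, in homogeneous coordinates and without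
  normalising \<open>|A|\<^sup>2 + |B|\<^sup>2\<close>; the form treats \<open>(z - b) / (1 + z b')\<close>, with \<open>b'\<close> the conjugate of \<open>b\<close>,
  and \<open>- 1 / z\<close> alike. Its values are complex numbers, so it is only meaningful away from the
  preimage of infinity, which is what \<open>moebius_finite\<close> excludes.\<close>

fun moebius_value :: "complex \<Rightarrow> complex \<Rightarrow> riemann_sphere \<Rightarrow> complex" where
  "moebius_value A B (Some w) = (A * w - B) / (cnj B * w + cnj A)"
| "moebius_value A B None = A / cnj B"

fun moebius_finite :: "complex \<Rightarrow> complex \<Rightarrow> riemann_sphere \<Rightarrow> bool" where
  "moebius_finite A B (Some w) \<longleftrightarrow> cnj B * w + cnj A \<noteq> 0"
| "moebius_finite A B None \<longleftrightarrow> B \<noteq> 0"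

lemma moebius_norm_sum_pos: "A \<noteq> 0 \<or> B \<noteq> 0 \<Longrightarrow> (norm A)\<^sup>2 + (norm B)\<^sup>2 > 0" for A B :: complex
  by (auto simp: add_pos_nonneg add_nonneg_pos)

lemma moebius_norm_sum_neq_0:
  assumes "A \<noteq> 0 \<or> B \<noteq> 0" shows "A * cnj A + B * cnj B \<noteq> 0"
proof -
  have "A * cnj A + B * cnj B = of_real ((norm A)\<^sup>2 + (norm B)\<^sup>2)"
    unfolding of_real_add complex_norm_square ..
  then show ?thesis using moebius_norm_sum_pos[OF assms] by (metis of_real_eq_0_iff less_irrefl)
qed

lemma moebius_value_inj_on:
  assumes AB: "A \<noteq> 0 \<or> B \<noteq> 0"
  shows "inj_on (moebius_value A B) {x. moebius_finite A B x}"
proof (rule inj_onI, clarify)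
  fix x y
  assume fin: "moebius_finite A B x" "moebius_finite A B y" and eq: "moebius_value A B x = moebius_value A B y"
  note nz = moebius_norm_sum_neq_0[OF AB]
  have mixed: False if w: "moebius_finite A B (Some w)" and "B \<noteq> 0"
    and eq: "moebius_value A B (Some w) = moebius_value A B None" for w
  proof -
    have "(A * w - B) * cnj B = A * (cnj B * w + cnj A)"
      using that by (simp add: frac_eq_eq)
    then have "A * cnj A + B * cnj B = 0" by (simp add: algebra_simps)
    with nz show False by simp
  qed
  show "x = y"
  proof (cases x; cases y)
    fix v w assume xy: "x = Some v" "y = Some w"
    then have "(A * v - B) * (cnj B * w + cnj A) = (A * w - B) * (cnj B * v + cnj A)"
      using fin eq by (simp add: frac_eq_eq)
    then have "(A * cnj A + B * cnj B) * (v - w) = 0" by (simp add: algebra_simps)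
    with nz xy show ?thesis by simp
  qed (use fin eq mixed in \<open>auto dest: sym\<close>)
qed

lemma nicely_meromorphic_eventually_not_pole:
  assumes "f nicely_meromorphic_on S" "z \<in> S"
  shows "eventually (\<lambda>w. \<not> is_pole f w) (at z)"
  using assms unfolding nicely_meromorphic_on_def
  by (metis eventually_not_pole meromorphic_onE)

text \<open>At a pole of \<open>f\<close> the numerator and denominator are divided by \<open>f\<close>: the function \<open>1 / f\<close> is
  analytic there, and the convention \<open>f z = 0\<close> at poles makes \<open>inverse (f z)\<close> its correct value 0.\<close>

lemma moebius_value_holomorphic:
  assumes f: "f nicely_meromorphic_on S"
    and fin: "\<And>z. z \<in> S \<Longrightarrow> moebius_finite A B (sphere_map f z)"
  shows "(\<lambda>z. moebius_value A B (sphere_map f z)) holomorphic_on S"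
proof -
  let ?g = "\<lambda>z. moebius_value A B (sphere_map f z)"
  have "?g analytic_on {z}" if z: "z \<in> S" for z
  proof (cases "is_pole f z")
    case False
    then have an: "f analytic_on {z}"
      using f z by (rule nicely_meromorphic_on_imp_analytic_at[rotated 2])
    have "eventually (\<lambda>w. \<not> is_pole f w) (nhds z)"
      using nicely_meromorphic_eventually_not_pole[OF f z] False
      unfolding eventually_nhds_conv_at by simp
    then have "eventually (\<lambda>w. ?g w = (A * f w - B) / (cnj B * f w + cnj A)) (nhds z)"
      by eventually_elim (simp add: sphere_map_def)
    moreover have "(\<lambda>w. (A * f w - B) / (cnj B * f w + cnj A)) analytic_on {z}"
      using fin[OF z] False by (intro analytic_intros an) (auto simp: sphere_map_def)
    ultimately show ?thesis by (simp add: analytic_at_cong)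
  next
    case True
    let ?i = "\<lambda>w. inverse (f w)"
    have lim: "(?i \<longlongrightarrow> 0) (at z)" using is_pole_tendsto[OF True] by (simp add: o_def)
    then have "\<not> is_pole ?i z"
      unfolding is_pole_def by (meson at_neq_bot not_tendsto_and_filterlim_at_infinity)
    then have an: "?i analytic_on {z}"
      using nicely_meromorphic_on_inverse[OF f] z by (intro nicely_meromorphic_on_imp_analytic_at)
    have fz: "f z = 0"
      using f z True unfolding nicely_meromorphic_on_def is_pole_def
      by (meson at_neq_bot not_tendsto_and_filterlim_at_infinity)
    have B: "B \<noteq> 0" using fin[OF z] True by (simp add: sphere_map_def)
    have "eventually (\<lambda>w. f w \<noteq> 0) (at z)"
      using True unfolding is_pole_def by (rule filterlim_at_infinity_imp_eventually_ne)
    then have "eventually (\<lambda>w. ?g w = (A - B * ?i w) / (cnj B + cnj A * ?i w)) (at z)"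
      using nicely_meromorphic_eventually_not_pole[OF f z]
    proof eventually_elim
      case (elim w)
      then have "A - B * ?i w = (A * f w - B) / f w" "cnj B + cnj A * ?i w = (cnj B * f w + cnj A) / f w"
        by (simp_all add: field_simps)
      with elim show ?case by (simp add: sphere_map_def)
    qed
    moreover have "?g z = (A - B * ?i z) / (cnj B + cnj A * ?i z)"
      using True fz by (simp add: sphere_map_def)
    ultimately have "eventually (\<lambda>w. ?g w = (A - B * ?i w) / (cnj B + cnj A * ?i w)) (nhds z)"
      unfolding eventually_nhds_conv_at by simp
    moreover have "(\<lambda>w. (A - B * ?i w) / (cnj B + cnj A * ?i w)) analytic_on {z}"
      using B fz by (intro analytic_intros an) auto
    ultimately show ?thesis by (simp add: analytic_at_cong)
  qed
  then have "?g analytic_on S" using analytic_on_analytic_at by blast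
  then show ?thesis by (rule analytic_imp_holomorphic)
qed

text \<open>Invariance of the spherical derivative under rotations: off the poles, \<open>|f'|\<close> and \<open>1 + |f|\<^sup>2\<close>
  both acquire the factor \<open>(|A|\<^sup>2 + |B|\<^sup>2) / |cnj B f + cnj A|\<^sup>2\<close> when \<open>f\<close> is replaced by \<open>g\<close>.
  At a pole, the left-hand side is a limit of values at nearby regular points, and the right-hand
  side is continuous.\<close>

lemma spherical_deriv_moebius_value:
  assumes f: "f nicely_meromorphic_on S" and S: "open S"
    and AB: "A \<noteq> 0 \<or> B \<noteq> 0"
    and fin: "\<And>z. z \<in> S \<Longrightarrow> moebius_finite A B (sphere_map f z)"
    and z: "z \<in> S"
    and g_eq: "\<And>w. w \<in> S \<Longrightarrow> g w = moebius_value A B (sphere_map f w)"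
  shows "spherical_deriv f z = norm (deriv g z) / (1 + (norm (g z))\<^sup>2)"
proof -
  have hol: "g holomorphic_on S"
    using moebius_value_holomorphic[OF f fin] g_eq by (simp cong: holomorphic_cong)
  have regular: "norm (deriv f w) / (1 + (norm (f w))\<^sup>2) = norm (deriv g w) / (1 + (norm (g w))\<^sup>2)"
    if w: "w \<in> S" "\<not> is_pole f w" for w
  proof -
    define D where "D = cnj B * f w + cnj A"
    define d where "d = (norm A)\<^sup>2 + (norm B)\<^sup>2"
    have D: "D \<noteq> 0" using fin[OF w(1)] w(2) by (simp add: D_def sphere_map_def)
    have d: "d > 0" using moebius_norm_sum_pos[OF AB] by (simp add: d_def)
    have "f analytic_on {w}"
      using f w by (rule nicely_meromorphic_on_imp_analytic_at)
    then have "(f has_field_derivative deriv f w) (at w)"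
      using analytic_on_imp_differentiable_at DERIV_deriv_iff_field_differentiable by blast
    note [derivative_intros] = this
    have "eventually (\<lambda>v. \<not> is_pole f v) (nhds w)"
      using nicely_meromorphic_eventually_not_pole[OF f w(1)] w(2)
      unfolding eventually_nhds_conv_at by simp
    moreover have "eventually (\<lambda>v. v \<in> S) (nhds w)"
      using S w(1) by (rule eventually_nhds_in_open)
    ultimately have "eventually (\<lambda>v. g v = (A * f v - B) / (cnj B * f v + cnj A)) (nhds w)"
      by eventually_elim (simp add: sphere_map_def g_eq)
    then have "deriv g w = deriv (\<lambda>v. (A * f v - B) / (cnj B * f v + cnj A)) w"
      by (intro deriv_cong_ev) auto
    also have "\<dots> = deriv f w * of_real d / D\<^sup>2"
    proof (rule DERIV_imp_deriv)
      have "((\<lambda>v. (A * f v - B) / (cnj B * f v + cnj A)) has_field_derivative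
          (A * deriv f w * D - (A * f w - B) * (cnj B * deriv f w)) / (D * D)) (at w)"
        using D unfolding D_def by (auto intro!: derivative_eq_intros)
      moreover have "A * deriv f w * D - (A * f w - B) * (cnj B * deriv f w) = deriv f w * of_real d"
        unfolding D_def d_def of_real_add complex_norm_square by (simp add: algebra_simps)
      ultimately show "((\<lambda>v. (A * f v - B) / (cnj B * f v + cnj A)) has_field_derivative
          deriv f w * of_real d / D\<^sup>2) (at w)"
        by (simp add: power2_eq_square)
    qed
    finally have "norm (deriv g w) = norm (deriv f w) * d / (norm D)\<^sup>2"
      using d by (simp add: norm_mult norm_divide norm_power)
    moreover have "1 + (norm (g w))\<^sup>2 = d * (1 + (norm (f w))\<^sup>2) / (norm D)\<^sup>2"
    proof -
      have "(norm D)\<^sup>2 + (norm (A * f w - B))\<^sup>2 = d * (1 + (norm (f w))\<^sup>2)"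
        unfolding D_def d_def cmod_power2 by (simp add: algebra_simps power2_eq_square)
      note sum = this
      have "g w = (A * f w - B) / D"
        using w g_eq by (simp add: sphere_map_def D_def)
      then show ?thesis
        unfolding sum[symmetric] using D by (simp add: norm_divide power_divide add_divide_distrib)
    qed
    ultimately show ?thesis using D d by simp
  qed
  show ?thesis
  proof (cases "is_pole f z")
    case True
    have hol': "deriv g holomorphic_on S" using hol S by (rule holomorphic_deriv)
    have "continuous_on S (\<lambda>w. norm (deriv g w) / (1 + (norm (g w))\<^sup>2))"
      using holomorphic_on_imp_continuous_on[OF hol] holomorphic_on_imp_continuous_on[OF hol']
      by (intro continuous_intros) (auto simp: add_nonneg_eq_0_iff)
    then have "((\<lambda>w. norm (deriv g w) / (1 + (norm (g w))\<^sup>2)) \<longlongrightarrow>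
        norm (deriv g z) / (1 + (norm (g z))\<^sup>2)) (at z)"
      using S z continuous_on_eq_continuous_at isCont_def by blast
    moreover have "eventually (\<lambda>w. norm (deriv g w) / (1 + (norm (g w))\<^sup>2) =
        norm (deriv f w) / (1 + (norm (f w))\<^sup>2)) (at z)"
      using nicely_meromorphic_eventually_not_pole[OF f z] eventually_at_in_open'[OF S z]
      by eventually_elim (simp add: regular)
    ultimately have "((\<lambda>w. norm (deriv f w) / (1 + (norm (f w))\<^sup>2)) \<longlongrightarrow>
        norm (deriv g z) / (1 + (norm (g z))\<^sup>2)) (at z)"
      by (rule Lim_transform_eventually)
    then show ?thesis
      using True by (simp add: spherical_deriv_def tendsto_Lim)
  qed (use regular z in \<open>simp add: spherical_deriv_def\<close>)
qed

text \<open>Following \<open>f\<close> by the inverse rotation gives \<open>z \<mapsto> \<zeta> z\<close> with \<open>|\<zeta>| = 1\<close>, and the spherical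
  derivative does not change.\<close>

lemma spherical_deriv_isometry:
  assumes f: "f nicely_meromorphic_on S" and S: "open S" and "\<rho> \<in> Rot"
    and eq: "\<And>z. z \<in> S \<Longrightarrow> sphere_map f z = \<rho> (Some z)" and z: "z \<in> S"
  shows "spherical_deriv f z = 1 / (1 + (norm z)\<^sup>2)"
proof -
  obtain A B \<zeta> where AB: "A \<noteq> 0 \<or> B \<noteq> 0" and \<zeta>: "norm \<zeta> = 1"
    and inv: "\<And>w. moebius_finite A B (\<rho> (Some w)) \<and> moebius_value A B (\<rho> (Some w)) = \<zeta> * w"
  proof -
    from \<open>\<rho> \<in> Rot\<close> consider (rot) \<theta> a where "\<rho> = rotation \<theta> a" | (inv) \<theta> where "\<rho> = inversion_rotation \<theta>"
      unfolding Rot_def by auto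
    then show ?thesis
    proof cases
      case rot
      let ?b = "- (a * cis \<theta>)"
      have cis: "cis \<theta> * cnj (cis \<theta>) = 1" by (simp add: cis_cnj cis_mult)
      have pos: "1 + a * cnj a \<noteq> 0" using moebius_norm_sum_neq_0[of 1 a] by simp
      have "moebius_finite 1 ?b (\<rho> (Some w)) \<and> moebius_value 1 ?b (\<rho> (Some w)) = cis \<theta> * w" for w
      proof (cases "1 + w * cnj a = 0")
        case True
        then have a: "a \<noteq> 0" by auto
        have "cis \<theta> * w * cnj ?b = - (w * cnj a) * (cis \<theta> * cnj (cis \<theta>))"
          by simp
        also have "\<dots> = 1" using True cis by (simp add: add_eq_0_iff)
        finally have "1 / cnj ?b = cis \<theta> * w"
          using a by (metis cis_neq_zero complex_cnj_zero_iff mult_eq_0_iff neg_equal_0_iff_equal nonzero_divide_eq_eq)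
        then show ?thesis using True a by (simp add: rot)
      next
        case False
        define v where "v = cis \<theta> * ((w - a) / (1 + w * cnj a))"
        have "cnj ?b * v + 1 = - cnj a * ((w - a) / (1 + w * cnj a)) * (cis \<theta> * cnj (cis \<theta>)) + 1"
          by (simp add: v_def)
        also have "\<dots> = (1 + a * cnj a) / (1 + w * cnj a)"
          unfolding cis using False by (simp add: field_simps)
        finally have den: "cnj ?b * v + 1 = (1 + a * cnj a) / (1 + w * cnj a)" .
        have num: "v - ?b = cis \<theta> * w * ((1 + a * cnj a) / (1 + w * cnj a))"
          using False by (simp add: v_def field_simps)
        have "\<rho> (Some w) = Some v" using False by (simp add: rot v_def)
        moreover have "(1 + a * cnj a) / (1 + w * cnj a) \<noteq> 0" using pos False by simp
        ultimately show ?thesis using den num by simp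
      qed
      then show ?thesis by (intro that[of 1 ?b "cis \<theta>"]) auto
    next
      case inv
      have "moebius_finite 0 1 (\<rho> (Some w)) \<and> moebius_value 0 1 (\<rho> (Some w)) = - cnj (cis \<theta>) * w" for w
        by (cases "w = 0") (auto simp: inv field_simps cis_cnj cis_mult)
      then show ?thesis by (intro that[of 0 1 "- cnj (cis \<theta>)"]) auto
    qed
  qed
  have "spherical_deriv f z = norm (deriv (\<lambda>w. \<zeta> * w) z) / (1 + (norm (\<zeta> * z))\<^sup>2)"
    by (rule spherical_deriv_moebius_value[OF f S AB _ z]) (use inv eq in auto)
  then show ?thesis using \<zeta> by (simp add: norm_mult)
qed

section \<open>Spherically convex sets lie in hemispheres\<close>

text \<open>In the orthonormal frame \<open>(p, u)\<close> with \<open>q = cos \<theta> p + sin \<theta> u\<close>, the vector is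
  \<open>cos t p + sin t u\<close> with \<open>sin t = \<beta> sin \<theta> \<ge> 0\<close> and \<open>sin (\<theta> - t) = \<alpha> sin \<theta> \<ge> 0\<close>. Hence \<open>0 \<le> t \<le> \<theta>\<close>.\<close>

lemma normalized_combination_in_minor_arc:
  fixes p q :: "'a::real_inner"
  assumes p: "norm p = 1" and q: "norm q = 1" and pq: "q \<noteq> p" "q \<noteq> - p"
    and \<alpha>\<beta>: "0 \<le> \<alpha>" "0 \<le> \<beta>" and x: "norm (\<alpha> *\<^sub>R p + \<beta> *\<^sub>R q) = 1"
  shows "\<alpha> *\<^sub>R p + \<beta> *\<^sub>R q \<in> minor_arc p q"
proof -
  have pp: "p \<bullet> p = 1" "q \<bullet> q = 1" using p q by (simp_all add: dot_square_norm)
  have "\<bar>p \<bullet> q\<bar> \<le> 1" using Cauchy_Schwarz_ineq2[of p q] p q by simp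
  moreover have "p \<bullet> q \<noteq> 1"
  proof
    assume "p \<bullet> q = 1"
    then have "(p - q) \<bullet> (p - q) = 0" using pp by (simp add: inner_diff inner_commute)
    with pq show False by simp
  qed
  moreover have "p \<bullet> q \<noteq> -1"
  proof
    assume "p \<bullet> q = -1"
    then have "(p + q) \<bullet> (p + q) = 0" using pp by (simp add: inner_add inner_commute)
    then have "p + q = 0" by simp
    then have "q = - p" by (metis add.inverse_unique)
    with pq show False by simp
  qed
  ultimately have c: "-1 < p \<bullet> q" "p \<bullet> q < 1" by auto
  define \<theta> where "\<theta> = arccos (p \<bullet> q)"
  have \<theta>: "0 < \<theta>" "\<theta> < pi" "cos \<theta> = p \<bullet> q"
    unfolding \<theta>_def using c by (auto intro: arccos_lt_bounded[THEN conjunct1] arccos_lt_bounded[THEN conjunct2])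
  have sin\<theta>: "sin \<theta> > 0" using \<theta> by (intro sin_gt_zero)
  define u where "u = (1 / sin \<theta>) *\<^sub>R (q - cos \<theta> *\<^sub>R p)"
  have pu: "p \<bullet> u = 0" unfolding u_def by (simp add: inner_diff pp \<theta>(3))
  have q_eq: "q = cos \<theta> *\<^sub>R p + sin \<theta> *\<^sub>R u" unfolding u_def using sin\<theta> by simp
  have u: "norm u = 1"
  proof -
    have "(q - cos \<theta> *\<^sub>R p) \<bullet> (q - cos \<theta> *\<^sub>R p) = 1 - (cos \<theta>)\<^sup>2"
      by (simp add: inner_diff pp \<theta>(3) inner_commute[of q p] power2_eq_square)
    then have "(norm (q - cos \<theta> *\<^sub>R p))\<^sup>2 = (sin \<theta>)\<^sup>2"
      by (simp add: dot_square_norm sin_squared_eq)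
    then have "norm (q - cos \<theta> *\<^sub>R p) = sin \<theta>"
      using sin\<theta> by (simp add: power2_eq_iff_nonneg)
    then show ?thesis unfolding u_def using sin\<theta> by simp
  qed
  have uu: "u \<bullet> u = 1" using u by (simp add: dot_square_norm)
  define a b where "a = \<alpha> + \<beta> * cos \<theta>" and "b = \<beta> * sin \<theta>"
  have x_eq: "\<alpha> *\<^sub>R p + \<beta> *\<^sub>R q = a *\<^sub>R p + b *\<^sub>R u"
    unfolding a_def b_def by (subst q_eq) (simp add: algebra_simps)
  have "(a *\<^sub>R p + b *\<^sub>R u) \<bullet> (a *\<^sub>R p + b *\<^sub>R u) = 1"
    using x unfolding x_eq by (simp add: dot_square_norm)
  then have ab: "a\<^sup>2 + b\<^sup>2 = 1"
    by (simp add: inner_add pp uu pu inner_commute[of u p] power2_eq_square)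
  have b0: "b \<ge> 0" unfolding b_def using \<alpha>\<beta> sin\<theta> by simp
  have a1: "\<bar>a\<bar> \<le> 1" using ab by (metis abs_square_le_1 le_add_same_cancel1 zero_le_power2)
  define t where "t = arccos a"
  have t: "0 \<le> t" "t \<le> pi" "cos t = a"
    unfolding t_def using a1 by (auto simp: arccos_lbound arccos_ubound)
  have sint: "sin t = b"
  proof -
    have "sin t = sqrt (1 - a\<^sup>2)" unfolding t_def using a1 by (intro sin_arccos) auto
    also have "1 - a\<^sup>2 = b\<^sup>2" using ab by simp
    finally show ?thesis using b0 by simp
  qed
  have "sin (\<theta> - t) = sin \<theta> * \<alpha>"
    unfolding sin_diff sint t(3) a_def b_def by (simp add: algebra_simps)
  then have "sin (\<theta> - t) \<ge> 0" using sin\<theta> \<alpha>\<beta> by simp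
  moreover have "sin (\<theta> - t) < 0" if "\<theta> < t"
  proof -
    have "0 < sin (t - \<theta>)" using that \<theta> t by (intro sin_gt_zero) auto
    then show ?thesis using sin_minus[of "t - \<theta>"] by simp
  qed
  ultimately have "t \<le> \<theta>" by linarith
  then show ?thesis
    unfolding minor_arc_def x_eq using u pu t \<theta> q_eq sint by blast
qed

lemma norm_stereo: "norm (stereo x) = 1"
proof (cases x)
  case (Some z)
  define n where "n = (norm z)\<^sup>2"
  have n: "n \<ge> 0" by (simp add: n_def)
  have "(2 / (1 + n) * norm z)\<^sup>2 + ((n - 1) / (n + 1))\<^sup>2 = 1"
  proof -
    have "(2 / (1 + n) * norm z)\<^sup>2 = 4 * n / (1 + n)\<^sup>2"
      by (simp add: power_mult_distrib power_divide n_def)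
    moreover have "((n - 1) / (n + 1))\<^sup>2 = (n - 1)\<^sup>2 / (1 + n)\<^sup>2"
      by (simp add: power_divide add.commute)
    moreover have "4 * n + (n - 1)\<^sup>2 = (1 + n)\<^sup>2" by (simp add: power2_eq_square algebra_simps)
    moreover have "(1 + n)\<^sup>2 \<noteq> 0" using n by simp
    ultimately show ?thesis by (metis add_divide_distrib divide_self)
  qed
  then show ?thesis using n by (simp add: Some norm_Pair n_def[symmetric] power_divide)
qed (simp add: norm_Pair)

text \<open>The usual formula for stereographic projection from the north pole \<open>(0, 1)\<close>.\<close>

lemma stereo_chart:
  fixes q :: "complex \<times> real"
  assumes "norm q = 1" "snd q \<noteq> 1"
  shows "stereo (Some ((1 / (1 - snd q)) *\<^sub>R fst q)) = q"
proof -
  obtain w h where q: "q = (w, h)" by fastforce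
  have wh: "(norm w)\<^sup>2 = (1 - h) * (1 + h)"
    using assms by (simp add: q norm_Pair power2_eq_square algebra_simps)
  have h: "1 - h \<noteq> 0" using assms by (simp add: q)
  define z where "z = (1 / (1 - h)) *\<^sub>R w"
  define n where "n = (norm z)\<^sup>2"
  have n: "n = (1 + h) / (1 - h)"
    unfolding n_def z_def norm_scaleR power_mult_distrib wh using h
    by (simp add: power2_eq_square divide_simps)
  have "2 / (1 + n) = 1 - h" "(n - 1) / (n + 1) = h"
    unfolding n using h by (simp_all add: field_simps)
  then have "stereo (Some z) = ((1 - h) *\<^sub>R z, h)" by (simp add: n_def)
  then show ?thesis using h by (simp add: q z_def)
qed

lemma stereo_surj:
  assumes "norm q = 1" obtains x where "stereo x = q"
proof (cases "snd q = 1")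
  case True
  then have "stereo None = q"
    using assms by (cases q) (auto simp: norm_Pair)
  then show ?thesis using that by blast
qed (use stereo_chart[OF assms] that in blast)

lemma inj_stereo: "inj stereo"
proof -
  have chart: "(1 / (1 - snd (stereo (Some z)))) *\<^sub>R fst (stereo (Some z)) = z" for z
  proof -
    have pos: "1 + (norm z)\<^sup>2 > 0" by (simp add: add_pos_nonneg)
    define d where "d = 2 / (1 + (norm z)\<^sup>2)"
    have "d \<noteq> 0" using pos by (simp add: d_def)
    moreover have "1 - d = ((norm z)\<^sup>2 - 1) / ((norm z)\<^sup>2 + 1)"
      using pos by (simp add: d_def field_simps)
    then have eq: "stereo (Some z) = (d *\<^sub>R z, 1 - d)" by (simp add: d_def)
    ultimately show ?thesis unfolding eq by simp
  qed
  have "snd (stereo (Some z)) \<noteq> 1" for z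
  proof -
    have "(norm z)\<^sup>2 + 1 > 0" by (simp add: add_nonneg_pos)
    then show ?thesis by (simp add: divide_eq_eq)
  qed
  then have fin: "stereo (Some z) \<noteq> stereo None" for z by (metis snd_conv stereo.simps(2))
  show ?thesis
  proof (rule injI)
    fix x y assume "stereo x = stereo y"
    then show "x = y" using chart fin by (cases x; cases y) metis+
  qed
qed

text \<open>Geodesic convexity of a subset of the sphere in linear terms: the cone over it is convex, as long
  as antipodal pairs are kept apart.\<close>

lemma spherically_convex_combination:
  assumes conv: "spherically_convex \<Omega>"
    and p: "p \<in> stereo ` \<Omega>" and q: "q \<in> stereo ` \<Omega>" and anti: "q \<noteq> - p"
    and \<alpha>\<beta>: "0 \<le> \<alpha>" "0 \<le> \<beta>" "\<alpha> \<noteq> 0 \<or> \<beta> \<noteq> 0"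
  shows "\<alpha> *\<^sub>R p + \<beta> *\<^sub>R q \<noteq> 0" "sgn (\<alpha> *\<^sub>R p + \<beta> *\<^sub>R q) \<in> stereo ` \<Omega>"
proof -
  have np: "norm p = 1" and nq: "norm q = 1" using p q norm_stereo by auto
  let ?x = "\<alpha> *\<^sub>R p + \<beta> *\<^sub>R q"
  show nz: "?x \<noteq> 0"
  proof
    assume "?x = 0"
    then have eq: "\<alpha> *\<^sub>R p = - (\<beta> *\<^sub>R q)" by (simp add: add_eq_0_iff2)
    then have "norm (\<alpha> *\<^sub>R p) = norm (\<beta> *\<^sub>R q)" by simp
    then have "\<alpha> = \<beta>" using np nq \<alpha>\<beta> by simp
    with eq \<alpha>\<beta> have "p = - q" by (metis scaleR_cancel_left scaleR_minus_right)
    with anti show False by simp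
  qed
  show "sgn ?x \<in> stereo ` \<Omega>"
  proof (cases "q = p")
    case True
    have "\<alpha> + \<beta> > 0" using \<alpha>\<beta> by linarith
    then have "sgn ((\<alpha> + \<beta>) *\<^sub>R p) = p"
      using np by (simp add: sgn_div_norm)
    then show ?thesis using p True by (simp add: scaleR_left_distrib)
  next
    case False
    from p q obtain a b where ab: "p = stereo a" "q = stereo b" "a \<in> \<Omega>" "b \<in> \<Omega>" by auto
    have sgn_eq: "sgn ?x = (\<alpha> / norm ?x) *\<^sub>R p + (\<beta> / norm ?x) *\<^sub>R q"
      by (simp add: sgn_div_norm scaleR_right_distrib divide_inverse mult.commute)
    have "sgn ?x \<in> minor_arc p q"
      unfolding sgn_eq
      by (rule normalized_combination_in_minor_arc[OF np nq False anti])
         (use \<alpha>\<beta> nz in \<open>simp_all add: norm_sgn flip: sgn_eq\<close>)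
    moreover obtain c where c: "stereo c = sgn ?x"
      using stereo_surj[of "sgn ?x"] nz by (auto simp: norm_sgn)
    ultimately have "c \<in> spherical_geodesic a b" by (simp add: spherical_geodesic_def ab)
    moreover have "\<not> antipodal a b" using anti ab by (simp add: antipodal_def)
    ultimately have "c \<in> \<Omega>" using conv ab unfolding spherically_convex_def by blast
    then show ?thesis using c by (metis image_eqI)
  qed
qed

lemma open_finite_part:
  assumes "spherically_convex \<Omega>" shows "open {z. Some z \<in> \<Omega>}"
proof -
  have "openin (Alexandroff_compactification euclidean) \<Omega>"
    using assms by (simp add: spherically_convex_def sphere_domain_def sphere_topology_def)
  then consider U where "open U" "\<Omega> = Some ` U" | C where "closed C" "\<Omega> = insert None (Some ` (UNIV - C))"
    unfolding openin_Alexandroff_compactification by auto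
  then show ?thesis
  proof cases
    case 1
    then have "{z. Some z \<in> \<Omega>} = U" by auto
    with 1 show ?thesis by simp
  next
    case 2
    then have "{z. Some z \<in> \<Omega>} = - C" by auto
    with 2 show ?thesis by (simp add: open_Compl)
  qed
qed

text \<open>Given antipodal points \<open>p\<close> and \<open>- p\<close> and a third point \<open>x\<close>, move \<open>p\<close> a little towards \<open>x\<close>, staying in
  the open set. The geodesic from the new point to \<open>- p\<close> is unique and passes through \<open>x\<close>. For the
  small move the stereographic chart is used, so the argument is made for whichever of the two
  points is not the north pole.\<close>

lemma spherically_convex_antipodal_imp_UNIV:
  assumes conv: "spherically_convex \<Omega>"
    and p: "p \<in> stereo ` \<Omega>" "- p \<in> stereo ` \<Omega>"
  shows "\<Omega> = UNIV"
proof -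
  have finite_case: "stereo c \<in> stereo ` \<Omega>"
    if p: "p \<in> stereo ` \<Omega>" "- p \<in> stereo ` \<Omega>" "snd p \<noteq> 1" for p c
  proof (cases "stereo c = p \<or> stereo c = - p")
    case False
    define x where "x = stereo c"
    have np: "norm p = 1" using p norm_stereo by auto
    \<comment> \<open>The point \<open>p\<close>, moved towards \<open>x\<close>, and the chart at \<open>p\<close>.\<close>
    define q where "q \<epsilon> = sgn (p + \<epsilon> *\<^sub>R x)" for \<epsilon> :: real
    define \<phi> where "\<phi> y = (1 / (1 - snd y)) *\<^sub>R fst y" for y :: "complex \<times> real"
    have q0: "q 0 = p" using np by (simp add: q_def sgn_div_norm)
    have cont_q: "isCont q 0"
      unfolding q_def using np by (intro continuous_intros) auto
    have "isCont \<phi> (q 0)"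
      unfolding \<phi>_def q0 using p(3) by (intro continuous_intros) auto
    then have "isCont (\<lambda>\<epsilon>. \<phi> (q \<epsilon>)) 0" using cont_q by (rule isCont_o2[rotated])
    then have "((\<lambda>\<epsilon>. \<phi> (q \<epsilon>)) \<longlongrightarrow> \<phi> p) (at 0)" by (simp add: isCont_def q0)
    moreover have "Some (\<phi> p) \<in> \<Omega>"
      using stereo_chart[OF np p(3)] p(1) inj_stereo unfolding \<phi>_def by (metis inj_image_mem_iff)
    ultimately have ev1: "eventually (\<lambda>\<epsilon>. Some (\<phi> (q \<epsilon>)) \<in> \<Omega>) (at 0)"
      using topological_tendstoD[OF _ open_finite_part[OF conv]] by fastforce
    have "((\<lambda>\<epsilon>. snd (q \<epsilon>)) \<longlongrightarrow> snd p) (at 0)"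
      using cont_q unfolding isCont_def q0 by (intro tendsto_intros)
    then have ev2: "eventually (\<lambda>\<epsilon>. snd (q \<epsilon>) \<noteq> 1) (at 0)"
      using p(3) tendsto_imp_eventually_ne by blast
    have ev3: "eventually (\<lambda>\<epsilon>::real. \<epsilon> > 0) (at_right 0)"
      by (simp add: eventually_at_right_less)
    have "eventually (\<lambda>\<epsilon>. Some (\<phi> (q \<epsilon>)) \<in> \<Omega> \<and> snd (q \<epsilon>) \<noteq> 1 \<and> \<epsilon> > 0) (at_right 0)"
      using ev1 ev2 ev3 by (auto simp: eventually_at_split eventually_conj_iff)
    then obtain \<epsilon> where \<epsilon>: "Some (\<phi> (q \<epsilon>)) \<in> \<Omega>" "snd (q \<epsilon>) \<noteq> 1" "\<epsilon> > 0"
      using eventually_happens trivial_limit_at_right_real by blast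
    let ?n = "norm (p + \<epsilon> *\<^sub>R x)"
    have nx: "norm x = 1" by (simp add: x_def norm_stereo)
    have nz: "p + \<epsilon> *\<^sub>R x \<noteq> 0"
    proof
      assume "p + \<epsilon> *\<^sub>R x = 0"
      then have eq: "p = - (\<epsilon> *\<^sub>R x)" by (simp add: add_eq_0_iff2)
      then have "\<epsilon> = 1" using np nx \<epsilon> by (metis abs_of_pos mult.right_neutral norm_minus_cancel norm_scaleR)
      with eq False show False by (simp add: x_def)
    qed
    have "stereo (Some (\<phi> (q \<epsilon>))) = q \<epsilon>"
      unfolding \<phi>_def using \<epsilon> nz by (intro stereo_chart) (auto simp: q_def norm_sgn)
    then have q_in: "q \<epsilon> \<in> stereo ` \<Omega>" using \<epsilon>(1) by (metis image_eqI)
    have comb: "\<epsilon> *\<^sub>R x = ?n *\<^sub>R q \<epsilon> + 1 *\<^sub>R (- p)"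
      using nz by (simp add: q_def sgn_div_norm)
    have "q \<epsilon> \<noteq> p"
    proof
      assume "q \<epsilon> = p"
      with comb have "\<epsilon> *\<^sub>R x = (?n - 1) *\<^sub>R p" by (simp add: algebra_simps)
      then have eq: "x = ((?n - 1) / \<epsilon>) *\<^sub>R p"
        using \<epsilon>(3) by (metis divide_inverse_commute less_irrefl scaleR_one scaleR_scaleR left_inverse)
      then have "\<bar>(?n - 1) / \<epsilon>\<bar> = 1" using nx np by (metis mult.right_neutral norm_scaleR)
      then have "(?n - 1) / \<epsilon> = 1 \<or> (?n - 1) / \<epsilon> = -1" by linarith
      then have "x = p \<or> x = - p" using eq by (metis scaleR_minus_left scaleR_one)
      with False show False by (simp add: x_def)
    qed
    then have "sgn (?n *\<^sub>R q \<epsilon> + 1 *\<^sub>R (- p)) \<in> stereo ` \<Omega>"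
      by (intro spherically_convex_combination(2)[OF conv q_in p(2)]) auto
    then have "sgn (\<epsilon> *\<^sub>R x) \<in> stereo ` \<Omega>" using comb by simp
    moreover have "sgn (\<epsilon> *\<^sub>R x) = x" using \<epsilon> nx by (simp add: sgn_div_norm)
    ultimately show ?thesis by (simp add: x_def)
  qed (use that in auto)
  have "stereo c \<in> stereo ` \<Omega>" for c
  proof (cases "snd p = 1")
    case False
    then show ?thesis using finite_case p by blast
  next
    case True
    then show ?thesis using finite_case[of "- p"] p by simp
  qed
  then show ?thesis using inj_stereo by (auto simp: inj_image_mem_iff)
qed

text \<open>The cone over the set is convex and does not contain 0, so a closed half-space with 0 on its
  boundary contains it. The inner unit normal of that half-space is the centre of the hemisphere.\<close>

theorem spherically_convex_hemisphere:
  assumes conv: "spherically_convex \<Omega>" and "\<Omega> \<noteq> UNIV"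
  obtains b where "\<And>x. x \<in> \<Omega> \<Longrightarrow> 0 \<le> stereo b \<bullet> stereo x"
proof -
  define K where "K = {y. y \<noteq> 0 \<and> sgn y \<in> stereo ` \<Omega>}"
  have "convex K"
  proof (rule convexI)
    fix x y :: "complex \<times> real" and u v :: real
    assume xy: "x \<in> K" "y \<in> K" and uv: "0 \<le> u" "0 \<le> v" "u + v = 1"
    have "sgn y \<noteq> - sgn x"
      using spherically_convex_antipodal_imp_UNIV[OF conv, of "sgn x"] xy \<open>\<Omega> \<noteq> UNIV\<close>
      unfolding K_def by force
    moreover have "u * norm x \<noteq> 0 \<or> v * norm y \<noteq> 0" using xy uv by (auto simp: K_def)
    ultimately have "(u * norm x) *\<^sub>R sgn x + (v * norm y) *\<^sub>R sgn y \<in> K"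
      using xy uv spherically_convex_combination[OF conv, of "sgn x" "sgn y" "u * norm x" "v * norm y"]
      by (auto simp: K_def)
    moreover have "(w * norm z) *\<^sub>R sgn z = w *\<^sub>R z" if "z \<in> K" for w z
      using that by (simp add: sgn_div_norm K_def)
    ultimately show "u *\<^sub>R x + v *\<^sub>R y \<in> K"
      using xy by simp
  qed
  moreover have "0 \<notin> K" by (simp add: K_def)
  ultimately have "\<exists>a. a \<noteq> 0 \<and> (\<forall>x\<in>K. 0 \<le> a \<bullet> x)"
    by (rule separating_hyperplane_set_0)
  then obtain a where a: "a \<noteq> 0" "\<And>x. x \<in> K \<Longrightarrow> 0 \<le> a \<bullet> x" by auto
  obtain b where b: "stereo b = sgn a"
    using stereo_surj[of "sgn a"] a by (auto simp: norm_sgn)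
  have "0 \<le> stereo b \<bullet> stereo x" if "x \<in> \<Omega>" for x
  proof -
    have "stereo x \<in> K" using that norm_stereo[of x] by (auto simp: K_def sgn_div_norm)
    then show ?thesis using a by (simp add: b sgn_div_norm)
  qed
  then show ?thesis using that by blast
qed

text \<open>The closed hemisphere with centre \<open>b\<close> consists of the points that are at least as close to \<open>b\<close>
  as to its antipode, so it is where \<open>(w - b) / (1 + w b')\<close> has modulus at most 1, with \<open>b'\<close> the
  conjugate of \<open>b\<close>.\<close>

lemma inner_stereo_Some:
  "stereo (Some b) \<bullet> stereo (Some w) =
     ((norm (cnj b * w + 1))\<^sup>2 - (norm (w - b))\<^sup>2) / ((1 + (norm b)\<^sup>2) * (1 + (norm w)\<^sup>2))"
proof -
  have pos: "1 + (norm b)\<^sup>2 > 0" "1 + (norm w)\<^sup>2 > 0" by (simp_all add: add_pos_nonneg)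
  have "(norm (cnj b * w + 1))\<^sup>2 - (norm (w - b))\<^sup>2 =
      4 * (b \<bullet> w) + ((norm b)\<^sup>2 - 1) * ((norm w)\<^sup>2 - 1)"
    unfolding cmod_power2 inner_complex_def by (simp add: algebra_simps power2_eq_square)
  moreover have "stereo (Some b) \<bullet> stereo (Some w) =
      (4 * (b \<bullet> w) + ((norm b)\<^sup>2 - 1) * ((norm w)\<^sup>2 - 1)) / ((1 + (norm b)\<^sup>2) * (1 + (norm w)\<^sup>2))"
    using pos by (simp add: add_divide_distrib add.commute[of _ 1])
  ultimately show ?thesis by simp
qed

section \<open>From the hemisphere to the disc\<close>

text \<open>The plane is not conformally equivalent to a subset of the disc: if \<open>f\<close> were onto the sphere,
  deleting its single pole would leave an injective holomorphic map onto the plane, whose inverse is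
  entire and bounded, against Liouville's theorem.\<close>

lemma sphere_map_image_neq_UNIV:
  assumes f: "f nicely_meromorphic_on ball 0 1" and inj: "inj_on (sphere_map f) (ball 0 1)"
  shows "sphere_map f ` ball 0 1 \<noteq> UNIV"
proof
  assume onto: "sphere_map f ` ball 0 1 = UNIV"
  then obtain z0 where z0: "z0 \<in> ball 0 1" "sphere_map f z0 = None" by (metis UNIV_I imageE)
  have fin: "sphere_map f z = Some (f z)" "\<not> is_pole f z" if "z \<in> ball 0 1 - {z0}" for z
    using inj z0 that unfolding inj_on_def sphere_map_def by (metis DiffD1 DiffD2 singletonI)+
  have "f analytic_on (ball 0 1 - {z0})"
    using nicely_meromorphic_on_imp_analytic_at[OF f] fin(2) by (subst analytic_on_analytic_at) auto
  then have hol: "f holomorphic_on (ball 0 1 - {z0})" by (rule analytic_imp_holomorphic)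
  have inj': "inj_on f (ball 0 1 - {z0})"
    using inj fin(1) unfolding inj_on_def by (metis DiffD1)
  have image: "f ` (ball 0 1 - {z0}) = UNIV"
  proof -
    have "w \<in> f ` (ball 0 1 - {z0})" for w
    proof -
      obtain z where z: "z \<in> ball 0 1" "sphere_map f z = Some w" using onto by (metis UNIV_I imageE)
      with z0 have "z \<in> ball 0 1 - {z0}" by auto
      with z fin(1) show ?thesis by force
    qed
    then show ?thesis by auto
  qed
  obtain g where g: "g holomorphic_on UNIV" "\<And>z. z \<in> ball 0 1 - {z0} \<Longrightarrow> g (f z) = z"
    using holomorphic_has_inverse[OF hol _ inj'] unfolding image by (metis open_ball open_delete)
  have "g w \<in> ball 0 1 - {z0}" for w
    using image g(2) by (metis UNIV_I imageE)
  then have "range g \<subseteq> ball 0 1" by auto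
  then have "bounded (range g)" using bounded_ball bounded_subset by blast
  with g(1) have "g constant_on UNIV" by (rule Liouville_theorem)
  then obtain k where k: "\<And>w. g w = k" by (auto simp: constant_on_def)
  have "ball 0 1 - {z0} \<subseteq> {k}" using g(2) k by (metis singletonI subsetI)
  then have "finite (ball (0::complex) 1 - {z0})" by (rule finite_subset) simp
  then have "finite (ball (0::complex) 1)" by simp
  moreover have "infinite (ball (0::complex) 1)"
    using finite_imp_not_open[of "ball (0::complex) 1"] by auto
  ultimately show False by simp
qed

text \<open>These coefficients give the rotation that takes \<open>b\<close> to 0, and thus the hemisphere with centre \<open>b\<close>
  to the unit disc. A finite centre \<open>b\<close> needs \<open>(z - b) / (1 + z b')\<close>, with \<open>b'\<close> the conjugate of \<open>b\<close>,
  and the centre infinity needs \<open>- 1 / z\<close>.\<close>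

lemma hemisphere_moebius_cball:
  assumes "0 \<le> stereo b \<bullet> stereo x" and b: "(A, B) = (case b of None \<Rightarrow> (0, 1) | Some b \<Rightarrow> (1, b))"
  shows "moebius_finite A B x" "norm (moebius_value A B x) \<le> 1"
proof -
  have "moebius_finite A B x \<and> norm (moebius_value A B x) \<le> 1"
  proof (cases b)
    case None
    then have AB: "A = 0" "B = 1" using b by auto
    show ?thesis
    proof (cases x)
      case (Some w)
      have "(norm w)\<^sup>2 + 1 > 0" by (simp add: add_nonneg_pos)
      then have "1 \<le> (norm w)\<^sup>2"
        using assms(1) unfolding None Some by (simp add: zero_le_divide_iff)
      then have "1 \<le> norm w" by (metis norm_ge_zero one_power2 power2_le_imp_le)
      then show ?thesis by (auto simp: Some AB norm_divide divide_le_eq)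
    qed (simp add: AB)
  next
    case (Some c)
    then have AB: "A = 1" "B = c" using b by auto
    have pos: "1 + (norm c)\<^sup>2 > 0" by (simp add: add_pos_nonneg)
    show ?thesis
    proof (cases x)
      case None
      have "(norm c)\<^sup>2 + 1 > 0" by (simp add: add_nonneg_pos)
      then have "1 \<le> (norm c)\<^sup>2"
        using assms(1) unfolding None Some by (simp add: zero_le_divide_iff)
      then have "1 \<le> norm c" by (metis norm_ge_zero one_power2 power2_le_imp_le)
      then show ?thesis by (auto simp: None AB norm_divide divide_le_eq)
    next
      case x: (Some w)
      have numerator_nonneg: "0 \<le> n" if "0 \<le> n / d" "0 < d" for n d :: real
        using that by (simp add: zero_le_divide_iff)
      have "1 + (norm w)\<^sup>2 > 0" by (simp add: add_pos_nonneg)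
      with pos have "(1 + (norm c)\<^sup>2) * (1 + (norm w)\<^sup>2) > 0" by (rule mult_pos_pos)
      then have "(norm (w - c))\<^sup>2 \<le> (norm (cnj c * w + 1))\<^sup>2"
        using numerator_nonneg[OF assms(1)[unfolded Some x inner_stereo_Some]]
        by (simp only: diff_ge_0_iff_ge)
      then have le: "norm (w - c) \<le> norm (cnj c * w + 1)" by (rule power2_le_imp_le) simp
      have "cnj c * w + 1 \<noteq> 0"
      proof
        assume eq: "cnj c * w + 1 = 0"
        with le have "w = c" by simp
        with eq have "1 * cnj 1 + c * cnj c = 0" by (simp add: mult.commute add.commute)
        then show False using moebius_norm_sum_neq_0[of 1 c] by simp
      qed
      with le show ?thesis by (simp add: x AB norm_divide)
    qed
  qed
  then show "moebius_finite A B x" "norm (moebius_value A B x) \<le> 1" by auto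
qed

text \<open>Solving \<open>moebius_value A B x = \<alpha> z\<close> for \<open>x\<close> gives an element of the rotation group again, here
  brought into the two normal forms of \<open>Rot\<close>.\<close>

lemma moebius_value_eq_imp_Rot:
  assumes \<alpha>: "norm \<alpha> = 1"
    and b: "(A, B) = (case b of None \<Rightarrow> (0, 1) | Some b \<Rightarrow> (1, b))"
  obtains \<rho> where "\<rho> \<in> Rot"
    "\<And>x z. moebius_finite A B x \<Longrightarrow> moebius_value A B x = \<alpha> * z \<Longrightarrow> x = \<rho> (Some z)"
proof -
  obtain \<theta> where \<theta>: "\<alpha> = cis \<theta>" using \<alpha> by (metis complex_norm_eq_1_exp cis_conv_exp)
  have cis: "cis \<theta> * cnj (cis \<theta>) = 1" by (simp add: cis_cnj cis_mult)
  show ?thesis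
  proof (cases b)
    case None
    then have AB: "A = 0" "B = 1" using b by auto
    have "cis \<theta> * cis (pi - \<theta>) = -1" by (simp add: cis_mult)
    then have inv: "- (1 / cis \<theta>) = cis (pi - \<theta>)" by (simp add: field_simps)
    have "x = inversion_rotation (pi - \<theta>) (Some z)"
      if fin: "moebius_finite A B x" and eq: "moebius_value A B x = \<alpha> * z" for x z
    proof (cases x)
      case x: None
      then show ?thesis using eq by (simp add: AB \<theta>)
    next
      case (Some w)
      then have w: "w \<noteq> 0" "- 1 / w = cis \<theta> * z" using fin eq by (auto simp: AB \<theta>)
      then have "z \<noteq> 0" by auto
      have "w = - 1 / (- 1 / w)" using w(1) by simp
      also have "\<dots> = - (1 / cis \<theta>) / z" unfolding w(2) by simp
      finally have "w = cis (pi - \<theta>) / z" unfolding inv .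
      with \<open>z \<noteq> 0\<close> show ?thesis by (simp add: Some)
    qed
    then show ?thesis using that[of "inversion_rotation (pi - \<theta>)"] by (simp add: Rot_def)
  next
    case (Some c)
    then have AB: "A = 1" "B = c" using b by auto
    define a where "a = - (c * cnj (cis \<theta>))"
    have cnj_a: "cnj a = - (cnj c * cis \<theta>)" by (simp add: a_def)
    have c: "c = - (a * cis \<theta>)" using cis by (simp add: a_def mult.assoc mult.commute)
    have "x = rotation \<theta> a (Some z)"
      if fin: "moebius_finite A B x" and eq: "moebius_value A B x = \<alpha> * z" for x z
    proof (cases x)
      case None
      then have "cnj c \<noteq> 0" "1 = cis \<theta> * z * cnj c" using fin eq by (auto simp: AB \<theta> field_simps)
      then have "1 + z * cnj a = 0" by (simp add: cnj_a mult_ac)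
      then show ?thesis by (simp add: None)
    next
      case (Some w)
      then have "cnj c * w + 1 \<noteq> 0" "w - c = cis \<theta> * z * (cnj c * w + 1)"
        using fin eq by (auto simp: AB \<theta> field_simps)
      then have w: "w * (1 + z * cnj a) = cis \<theta> * (z - a)"
        by (simp add: cnj_a) (simp add: c algebra_simps)
      have "1 + z * cnj a \<noteq> 0"
      proof
        assume eq0: "1 + z * cnj a = 0"
        then have "z = a" using w by simp
        then show False using eq0 moebius_norm_sum_neq_0[of 1 a] by simp
      qed
      then show ?thesis using w by (simp add: Some nonzero_eq_divide_eq)
    qed
    then show ?thesis using that[of "rotation \<theta> a"] by (auto simp: Rot_def)
  qed
qed

section \<open>The length estimate\<close>

lemma spherical_length_image_eq:
  assumes "0 < r"
  shows "spherical_length_image f r =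
    2 * pi * r * integral {0..1} (\<lambda>t. spherical_deriv f (circlepath 0 r t))"
proof -
  have "spherical_length_image f r =
      integral {0..1} (\<lambda>t. 2 * pi * r * spherical_deriv f (circlepath 0 r t))"
    unfolding spherical_length_image_def arclength_integral_def
    by (rule integral_cong) (use assms in \<open>simp add: vector_derivative_circlepath01 norm_mult\<close>)
  then show ?thesis by simp
qed

lemma spherical_length_circle_eq:
  assumes "0 < r"
  shows "spherical_length_circle r = 2 * pi * r / (1 + r\<^sup>2)"
proof -
  have "spherical_length_circle r = integral {0..1} (\<lambda>t::real. 2 * pi * r / (1 + r\<^sup>2))"
    unfolding spherical_length_circle_def arclength_integral_def
    by (rule integral_cong)
       (use assms in \<open>simp add: vector_derivative_circlepath01 norm_mult norm_circlepath_0\<close>)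
  then show ?thesis by simp
qed

theorem theorem1p3:
  fixes f :: "complex \<Rightarrow> complex"
  assumes "spherically_convex_function f"
  shows "(\<forall>r::real. 0 < r \<and> r < 1 \<longrightarrow>
            spherical_length_image f r \<ge> spherical_length_circle r * spherical_deriv f 0) \<and>
         ((\<exists>r::real. 0 < r \<and> r < 1 \<and>
            spherical_length_image f r = spherical_length_circle r * spherical_deriv f 0)
          \<longleftrightarrow> is_spherical_isometry f)"
proof -
  have mero: "f nicely_meromorphic_on ball 0 1" and inj: "inj_on (sphere_map f) (ball 0 1)"
    and conv: "spherically_convex (sphere_map f ` ball 0 1)"
    using assms by (auto simp: spherically_convex_function_def)
  obtain b where b: "\<And>x. x \<in> sphere_map f ` ball 0 1 \<Longrightarrow> 0 \<le> stereo b \<bullet> stereo x"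
    using spherically_convex_hemisphere[OF conv sphere_map_image_neq_UNIV[OF mero inj]] by blast
  obtain A B :: complex where AB_def: "(A, B) = (case b of None \<Rightarrow> (0, 1) | Some b \<Rightarrow> (1, b))"
    by (metis surj_pair)
  then have AB: "A \<noteq> 0 \<or> B \<noteq> 0" by (auto split: option.splits)
  define g where "g z = moebius_value A B (sphere_map f z)" for z
  have fin: "moebius_finite A B (sphere_map f z)" and g_le1: "norm (g z) \<le> 1" if "z \<in> ball 0 1" for z
    unfolding g_def using hemisphere_moebius_cball[OF b AB_def] that by auto
  have holg: "g holomorphic_on ball 0 1"
    unfolding g_def using moebius_value_holomorphic[OF mero fin] .
  have "inj_on (moebius_value A B) (sphere_map f ` ball 0 1)"
    by (rule inj_on_subset[OF moebius_value_inj_on[OF AB]]) (use fin in auto)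
  from comp_inj_on[OF inj this] have injg: "inj_on g (ball 0 1)"
    by (simp add: g_def[abs_def] o_def)
  \<comment> \<open>The image of \<open>g\<close> is open, so it cannot touch the boundary of the hemisphere.\<close>
  have g_lt1: "norm (g z) < 1" if "norm z < 1" for z
  proof -
    have "open (g ` ball 0 1)" by (rule open_mapping_thm3[OF holg open_ball injg])
    moreover have "g ` ball 0 1 \<subseteq> cball 0 1" using g_le1 by auto
    ultimately have "g ` ball 0 1 \<subseteq> ball 0 1"
      using interior_maximal by (metis interior_cball)
    moreover have "g z \<in> g ` ball 0 1" using that by simp
    ultimately show ?thesis by (metis dist_0_norm mem_ball subsetD)
  qed
  have deriv_eq: "spherical_deriv f z = norm (deriv g z) / (1 + (norm (g z))\<^sup>2)" if "norm z < 1" for z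
    by (rule spherical_deriv_moebius_value[OF mero open_ball AB fin]) (use that in \<open>auto simp: g_def\<close>)
  let ?I = "\<lambda>r. integral {0..1} (\<lambda>t. spherical_deriv f (circlepath 0 r t))"
  have I_eq: "?I r = integral {0..1} (\<lambda>t. norm (deriv g (circlepath 0 r t)) / (1 + (norm (g (circlepath 0 r t)))\<^sup>2))"
    if "0 < r" "r < 1" for r
    by (rule integral_cong) (use that in \<open>simp add: deriv_eq norm_circlepath_0\<close>)
  have length: "spherical_length_image f r = (2 * pi * r) * ?I r"
    "spherical_length_circle r * spherical_deriv f 0 = (2 * pi * r) * (spherical_deriv f 0 / (1 + r\<^sup>2))"
    if "0 < r" for r
    using that by (simp_all add: spherical_length_image_eq spherical_length_circle_eq)
  note main = circle_mean_spherical_derivative_disc[OF holg injg g_lt1]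
  show ?thesis
  proof (intro conjI allI impI iffI)
    fix r :: real assume r: "0 < r \<and> r < 1"
    then have "spherical_deriv f 0 / (1 + r\<^sup>2) \<le> ?I r"
      using main(1)[of r] I_eq[of r] deriv_eq[of 0] by simp
    then show "spherical_length_circle r * spherical_deriv f 0 \<le> spherical_length_image f r"
      using r length[of r] mult_left_mono[of "spherical_deriv f 0 / (1 + r\<^sup>2)" "?I r" "2 * pi * r"] by simp
  next
    assume "\<exists>r::real. 0 < r \<and> r < 1 \<and>
            spherical_length_image f r = spherical_length_circle r * spherical_deriv f 0"
    then obtain r where r: "0 < r" "r < 1"
      "spherical_length_image f r = spherical_length_circle r * spherical_deriv f 0" by blast
    then have "(2 * pi * r) * ?I r = (2 * pi * r) * (spherical_deriv f 0 / (1 + r\<^sup>2))"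
      using length[OF r(1)] by argo
    then have "?I r = spherical_deriv f 0 / (1 + r\<^sup>2)"
      using r unfolding mult_cancel_left by simp
    then obtain \<alpha> where \<alpha>: "norm \<alpha> = 1" "\<And>z. norm z < 1 \<Longrightarrow> g z = \<alpha> * z"
      using main(2)[of r] I_eq[of r] deriv_eq[of 0] r by auto
    obtain \<rho> where "\<rho> \<in> Rot"
      "\<And>x z. moebius_finite A B x \<Longrightarrow> moebius_value A B x = \<alpha> * z \<Longrightarrow> x = \<rho> (Some z)"
      using moebius_value_eq_imp_Rot[OF \<alpha>(1) AB_def] by blast
    then show "is_spherical_isometry f"
      unfolding is_spherical_isometry_def using fin \<alpha>(2) by (force simp: g_def)
  next
    assume "is_spherical_isometry f"
    then obtain \<rho> where \<rho>: "\<rho> \<in> Rot" "\<And>z. z \<in> ball 0 1 \<Longrightarrow> sphere_map f z = \<rho> (Some z)"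
      unfolding is_spherical_isometry_def by blast
    have sd: "spherical_deriv f z = 1 / (1 + (norm z)\<^sup>2)" if "norm z < 1" for z
      using spherical_deriv_isometry[OF mero open_ball \<rho>] that by simp
    \<comment> \<open>Equality holds on every circle; one radius is enough.\<close>
    define r :: real where "r = 1 / 2"
    have r: "0 < r" "r < 1" by (auto simp: r_def)
    have "?I r = integral {0..1} (\<lambda>t::real. 1 / (1 + r\<^sup>2))"
      by (rule integral_cong) (use r in \<open>simp add: sd norm_circlepath_0\<close>)
    then have "spherical_length_image f r = spherical_length_circle r * spherical_deriv f 0"
      unfolding length[OF r(1)] by (simp add: sd)
    with r show "\<exists>r::real. 0 < r \<and> r < 1 \<and>
            spherical_length_image f r = spherical_length_circle r * spherical_deriv f 0" by blast
  qed
qed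

end
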